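(* Let $\mathbb{F}$ be a field, and let $u$ be an automorphism of an infinite-dimensional $\mathbb{F}$-vector space $V$, with no dominant eigenvalue. Then, for every split non-derogatory polynomial $p\in\mathbb{F}[t]$ with degree $2$, the automorphism $u$ is $p$-adjacent to an elementary automorphism of $V$.
   Context: A polynomial $p\in\mathbb{F}[t]$ is called non-derogatory if $p(0)\neq 0$. For $u\in\mathrm{End}(V)$, a scalar $\lambda\in\mathbb{F}$ is called a dominant eigenvalue of $u$ if $\mathrm{rk}(u-\lambda\,\mathrm{id}_V)<\dim V$ (inequality of cardinals). For $u,v\in\mathrm{GL}(V)$, one says that $u$ is $p$-adjacent to $v$ if there exists $a\in\mathrm{GL}(V)$ such that $p(a)=0$ and $au=v$. An automorphism $v$ of $V$ makes $V$ an $\mathbb{F}[t,t^{-1}]$-module $V^v$ with $t\cdot x=v(x)$ for all $x\in V$; $v$ is called elementary if $V^v$ is a free $\mathbb{F}[t,t^{-1}]$-module. *)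

theory Defs
  imports
    "HOL-Computational_Algebra.Polynomial"
    "HOL-Library.Poly_Mapping"
begin

definition non_derogatory :: "'a::field poly \<Rightarrow> bool" where
  "non_derogatory p \<longleftrightarrow> poly p 0 \<noteq> 0"

definition split_poly :: "'a::field poly \<Rightarrow> bool" where
  "split_poly p \<longleftrightarrow> (\<exists>c rs. p = smult c (\<Prod>r\<leftarrow>rs. [:- r, 1:]))"

definition is_free_module :: "('r::comm_ring_1 \<Rightarrow> 'b::ab_group_add \<Rightarrow> 'b) \<Rightarrow> bool" where
  "is_free_module s \<longleftrightarrow> module s \<and> (\<exists>B. \<not> module.dependent s B \<and> module.span s B = UNIV)"

definition GL :: "('a::field \<Rightarrow> 'b::ab_group_add \<Rightarrow> 'b) \<Rightarrow> ('b \<Rightarrow> 'b) set" where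
  "GL scale = {f. Vector_Spaces.linear scale scale f \<and> bij f}"

text \<open>The Hamel dimension of a subspace as a cardinal (the library's \<open>dim\<close> is
  natural-number-valued and is \<open>0\<close> in infinite dimension). It does not depend on the basis
  chosen: see \<open>cdim_eqI\<close> below.\<close>

definition cdim :: "('a::field \<Rightarrow> 'b::ab_group_add \<Rightarrow> 'b) \<Rightarrow> 'b set \<Rightarrow> 'b rel" where
  "cdim scale S =
    card_of (SOME B. \<not> module.dependent scale B \<and> module.span scale B = module.span scale S)"

definition rk :: "('a::field \<Rightarrow> 'b::ab_group_add \<Rightarrow> 'b) \<Rightarrow> ('b \<Rightarrow> 'b) \<Rightarrow> 'b rel" where
  "rk scale f = cdim scale (range f)"

definition dominant_eigenvalue :: "('a::field \<Rightarrow> 'b::ab_group_add \<Rightarrow> 'b) \<Rightarrow> ('b \<Rightarrow> 'b) \<Rightarrow> 'a \<Rightarrow> bool" where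
  "dominant_eigenvalue scale u l \<longleftrightarrow>
    (rk scale (\<lambda>x. u x - scale l x), cdim scale UNIV) \<in> ordLess"

definition poly_endo :: "('a::field \<Rightarrow> 'b::ab_group_add \<Rightarrow> 'b) \<Rightarrow> 'a poly \<Rightarrow> ('b \<Rightarrow> 'b) \<Rightarrow> 'b \<Rightarrow> 'b" where
  "poly_endo scale p a = (\<lambda>x. \<Sum>i\<le>degree p. scale (coeff p i) ((a ^^ i) x))"

definition p_adjacent :: "('a::field \<Rightarrow> 'b::ab_group_add \<Rightarrow> 'b) \<Rightarrow> 'a poly \<Rightarrow> ('b \<Rightarrow> 'b) \<Rightarrow> ('b \<Rightarrow> 'b) \<Rightarrow> bool" where
  "p_adjacent scale p u v \<longleftrightarrow> (\<exists>a \<in> GL scale. poly_endo scale p a = (\<lambda>x. 0) \<and> a \<circ> u = v)"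

definition int_funpow :: "('b \<Rightarrow> 'b) \<Rightarrow> int \<Rightarrow> 'b \<Rightarrow> 'b" where
  "int_funpow f k = (if k \<ge> 0 then f ^^ nat k else inv f ^^ nat (- k))"

text \<open>Finitely supported functions on \<open>int\<close> with convolution product, \<^typ>\<open>int \<Rightarrow>\<^sub>0 'a\<close>, form the
  ring of Laurent polynomials, \<open>lookup q k\<close> being the coefficient of \<open>t\<close> to the power \<open>k\<close>.
  The following is the scalar multiplication of the module associated with \<open>v\<close>, in which
  \<open>t\<close> acts as \<open>v\<close>: see \<open>module_laurent_scale\<close> below.\<close>

definition laurent_scale :: "('a::field \<Rightarrow> 'b::ab_group_add \<Rightarrow> 'b) \<Rightarrow> ('b \<Rightarrow> 'b) \<Rightarrow> (int \<Rightarrow>\<^sub>0 'a) \<Rightarrow> 'b \<Rightarrow> 'b" where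
  "laurent_scale scale v q x =
    (\<Sum>k\<in>Poly_Mapping.keys q. scale (Poly_Mapping.lookup q k) (int_funpow v k x))"

definition elementary :: "('a::field \<Rightarrow> 'b::ab_group_add \<Rightarrow> 'b) \<Rightarrow> ('b \<Rightarrow> 'b) \<Rightarrow> bool" where
  "elementary scale v \<longleftrightarrow> v \<in> GL scale \<and> is_free_module (laurent_scale scale v)"

context vector_space
begin

lemma cdim_eqI:
  assumes "independent B" "span B = span S"
  shows "(cdim scale S, card_of B) \<in> ordIso"
proof -
  define C where "C = (SOME B. independent B \<and> span B = span S)"
  have "independent C \<and> span C = span S"
    unfolding C_def by (rule someI[where x = B]) (use assms in simp)
  then obtain f where "bij_betw f C B"
    using bij_if_span_eq_span_bases[of C B] assms by auto
  then show ?thesis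
    unfolding cdim_def C_def[symmetric] using card_of_ordIso by blast
qed

end

lemma int_funpow_neg: "bij f \<Longrightarrow> int_funpow f (- int n) = inv f ^^ n"
  by (cases "n = 0") (auto simp: int_funpow_def)

lemma int_funpow_of_nat: "int_funpow f (int n) = f ^^ n"
  by (simp add: int_funpow_def)

lemma int_funpow_succ:
  assumes "bij f"
  shows "int_funpow f (k + 1) x = f (int_funpow f k x)"
proof (cases k)
  case (nonneg n)
  then have "k + 1 = int (Suc n)" by simp
  then show ?thesis using nonneg by (simp only: int_funpow_of_nat) simp
next
  case (neg n)
  then have "k + 1 = - int n" by simp
  moreover have "f ((inv f ^^ Suc n) x) = (inv f ^^ n) x"
    using assms by (simp add: bij_is_surj surj_f_inv_f)
  ultimately show ?thesis using neg assms by (simp only: int_funpow_neg)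
qed

lemma int_funpow_add:
  assumes "bij f"
  shows "int_funpow f (j + k) x = int_funpow f j (int_funpow f k x)"
proof (induction j rule: int_induct[where k = 0])
  case base
  show ?case by (simp add: int_funpow_def)
next
  case (step1 i)
  have "int_funpow f (i + 1 + k) x = f (int_funpow f (i + k) x)"
    using int_funpow_succ[OF assms, of "i + k"] by (simp add: ac_simps)
  then show ?case using step1 int_funpow_succ[OF assms, of i] by simp
next
  case (step2 i)
  have "f (int_funpow f (i - 1 + k) x) = int_funpow f (i + k) x"
    using int_funpow_succ[OF assms, of "i - 1 + k" x] by (simp add: algebra_simps)
  also have "\<dots> = f (int_funpow f (i - 1) (int_funpow f k x))"
    using step2 int_funpow_succ[OF assms, of "i - 1"] by simp
  finally show ?case using assms by (meson bij_is_inj injD)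
qed

context vector_space
begin

lemma linear_int_funpow:
  assumes "v \<in> GL scale"
  shows "Vector_Spaces.linear scale scale (int_funpow v k)"
proof -
  have v: "Vector_Spaces.linear scale scale v" "bij v" using assms by (auto simp: GL_def)
  interpret v: Vector_Spaces.linear scale scale v by (rule v)
  have inv: "Vector_Spaces.linear scale scale (inv v)"
  proof (rule linear_module_homI, unfold_locales)
    show "inv v (x + y) = inv v x + inv v y" for x y
      using v(2) by (metis v.add bij_inv_eq_iff)
    show "inv v (scale r x) = scale r (inv v x)" for r x
      using v(2) by (metis v.scale bij_inv_eq_iff)
  qed
  have pow: "Vector_Spaces.linear scale scale (f ^^ n)"
    if "Vector_Spaces.linear scale scale f" for f n
  proof (induction n)
    case 0
    show ?case using linear_ident by (simp add: id_def)
  next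
    case (Suc n)
    show ?case using Vector_Spaces.linear_compose[OF Suc that] by (simp add: o_def)
  qed
  show ?thesis by (auto simp: int_funpow_def intro!: pow v inv)
qed

lemma laurent_scale_superset:
  assumes "finite A" "Poly_Mapping.keys q \<subseteq> A"
  shows "laurent_scale scale v q x = (\<Sum>k\<in>A. scale (Poly_Mapping.lookup q k) (int_funpow v k x))"
  unfolding laurent_scale_def
  by (rule sum.mono_neutral_left) (use assms in \<open>auto simp: in_keys_iff\<close>)

lemma laurent_scale_add_left:
  "laurent_scale scale v (p + q) x = laurent_scale scale v p x + laurent_scale scale v q x"
proof -
  let ?A = "Poly_Mapping.keys p \<union> Poly_Mapping.keys q"
  have "Poly_Mapping.keys (p + q) \<subseteq> ?A" by (rule Poly_Mapping.keys_add)
  then show ?thesis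
    using laurent_scale_superset[of ?A "p + q" v x] laurent_scale_superset[of ?A p v x]
      laurent_scale_superset[of ?A q v x]
    by (simp add: lookup_add scale_left_distrib sum.distrib)
qed

lemma laurent_scale_single:
  "laurent_scale scale v (Poly_Mapping.single k c) x = scale c (int_funpow v k x)"
  using laurent_scale_superset[of "{k}" "Poly_Mapping.single k c" v x] by simp

lemma laurent_scale_add_right:
  assumes "v \<in> GL scale"
  shows "laurent_scale scale v q (x + y) = laurent_scale scale v q x + laurent_scale scale v q y"
proof -
  have "int_funpow v k (x + y) = int_funpow v k x + int_funpow v k y" for k
    using linear_int_funpow[OF assms, of k] by (simp add: linear_iff_module_hom module_hom.add)
  then show ?thesis by (simp add: laurent_scale_def scale_right_distrib sum.distrib)
qed

lemma laurent_scale_0: "laurent_scale scale v 0 x = 0"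
  by (simp add: laurent_scale_def)

lemma laurent_induct:
  fixes P :: "(int \<Rightarrow>\<^sub>0 'a) \<Rightarrow> bool"
  assumes "P 0" "\<And>p q. P p \<Longrightarrow> P q \<Longrightarrow> P (p + q)" "\<And>k c. P (Poly_Mapping.single k c)"
  shows "P q"
proof -
  have "P (\<Sum>k\<in>A. Poly_Mapping.single k (Poly_Mapping.lookup q k))" if "finite A" for A
    using that by induction (auto intro: assms)
  moreover have "q = (\<Sum>k\<in>Poly_Mapping.keys q. Poly_Mapping.single k (Poly_Mapping.lookup q k))"
    by (rule poly_mapping_eqI)
      (auto simp: lookup_sum lookup_single when_def in_keys_iff)
  ultimately show ?thesis by (metis finite_keys)
qed

lemma laurent_scale_mult:
  assumes "v \<in> GL scale"
  shows "laurent_scale scale v (p * q) x = laurent_scale scale v p (laurent_scale scale v q x)"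
proof (induction p rule: laurent_induct)
  case (3 j c)
  have bij: "bij v" using assms by (simp add: GL_def)
  interpret vj: Vector_Spaces.linear scale scale "int_funpow v j" by (rule linear_int_funpow[OF assms])
  show ?case
  proof (induction q rule: laurent_induct)
    case (3 k d)
    show ?case by (simp add: mult_single laurent_scale_single int_funpow_add[OF bij] vj.scale)
  next
    case (2 p q)
    then show ?case
      by (simp add: distrib_left laurent_scale_add_left laurent_scale_add_right[OF assms])
  qed (simp add: laurent_scale_0 laurent_scale_single vj.zero)
qed (simp_all add: laurent_scale_0 distrib_right laurent_scale_add_left)

lemma module_laurent_scale:
  assumes "v \<in> GL scale"
  shows "module (laurent_scale scale v)"
proof
  show "laurent_scale scale v 1 x = x" for x
    using laurent_scale_single[of v 0 1 x] by (simp add: int_funpow_def)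
qed (simp_all add: laurent_scale_add_right[OF assms] laurent_scale_add_left
      laurent_scale_mult[OF assms])

lemma laurent_scale_indeterminate: "laurent_scale scale v (Poly_Mapping.single 1 1) x = v x"
  by (simp add: laurent_scale_single int_funpow_def)

end

end

theory Submission
  imports Defs
begin

text \<open>
  Let \<open>p\<close> have the roots \<open>al\<close> and \<open>be\<close>. Since \<open>u\<close> has no dominant eigenvalue, a maximal set \<open>X\<close>
  such that \<open>X\<close> and \<open>u ` X\<close> are disjoint with independent union has the cardinality of a basis.
  Extend \<open>X \<union> u ` X\<close> to a basis \<open>B\<close>, and put \<open>W = span (u ` X)\<close> and \<open>G = B - u ` X\<close>. A linear
  map \<open>a\<close> that is \<open>al\<close> on \<open>W\<close> and \<open>be\<close> modulo \<open>W\<close> is annihilated by \<open>p\<close>. In terms of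
  \<open>v = a \<circ> u\<close> this means that \<open>v = al u\<close> on \<open>X\<close>, whereas on the basis vectors in \<open>B - X\<close> only
  \<open>v = be u\<close> modulo \<open>W\<close> is required. Let \<open>P\<close> be the projection onto \<open>span G\<close> along \<open>W\<close>. We may
  thus prescribe \<open>v c = be P (u c) + v (j c)\<close> for \<open>c \<in> B - X\<close>, with an arbitrary \<open>j c \<in> X\<close>.
  As a module over the Laurent polynomials, the space is then generated by \<open>G\<close> (as
  \<open>u x = v x / al\<close> for \<open>x \<in> X\<close>) with one relation for each \<open>c\<close>. Because \<open>X\<close> is as large as \<open>G\<close>,
  the \<open>j c\<close> can be chosen distinct and larger, in a well-founded order, than all other
  generators in the relation of \<open>c\<close>. So each relation eliminates its own generator \<open>j c\<close>, and the
  module is free on the generators that are not of the form \<open>j c\<close>.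
\<close>

section \<open>Cardinal arithmetic and a well-founded choice of generators\<close>

lemma card_of_finite_ordLess_infinite:
  "finite A \<Longrightarrow> infinite B \<Longrightarrow> (card_of A, card_of B) \<in> ordLess"
  by (rule finite_ordLess_infinite[OF card_of_Well_order card_of_Well_order]) (simp_all add: Field_card_of)

text \<open>This supplies the generators \<open>j g\<close> to be eliminated, each above the
  finitely many others in its relation. The well-order \<open>card_of G\<close> has minimal type, so
  its initial segments are smaller than \<open>G\<close>; and \<open>X\<close> is large enough to
  contain a disjoint row of size \<open>G\<close> for every \<open>g\<close>.\<close>

lemma well_founded_injection:
  assumes inf: "infinite G" and card: "(card_of G, card_of X) \<in> ordLeq" and "X \<subseteq> G"
    and S: "\<And>g. g \<in> G \<Longrightarrow> finite (S g)" "\<And>g. g \<in> G \<Longrightarrow> S g \<subseteq> G"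
  obtains j r where "wf r" "inj_on j G" "j ` G \<subseteq> X"
    "\<And>g s. g \<in> G \<Longrightarrow> s \<in> S g \<Longrightarrow> (s, j g) \<in> r"
proof -
  define r where "r = card_of G - Id"
  have wo: "well_order_on G (card_of G)" by (rule card_of_well_order_on)
  then have wf: "wf r" by (simp add: well_order_on_def r_def)
  have "(card_of (G \<times> G), card_of X) \<in> ordLeq"
    using card_of_Times_same_infinite[OF inf] card ordIso_ordLeq_trans by blast
  then obtain h where h: "inj_on h (G \<times> G)" "h ` (G \<times> G) \<subseteq> X"
    using card_of_ordLeq[of "G \<times> G" X] by auto
  have under: "(card_of (under (card_of G) s), card_of G) \<in> ordLess" if "s \<in> G" for s
  proof -
    have "(card_of (underS (card_of G) s), card_of G) \<in> ordLess"
      using card_of_underS[OF card_of_Card_order, of s G] that by (simp add: Field_card_of)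
    moreover have "(card_of {s}, card_of G) \<in> ordLess"
      by (rule card_of_finite_ordLess_infinite) (use inf in auto)
    ultimately have "(card_of (underS (card_of G) s \<union> {s}), card_of G) \<in> ordLess"
      by (rule card_of_Un_ordLess_infinite[OF inf])
    moreover have "under (card_of G) s \<subseteq> underS (card_of G) s \<union> {s}"
      by (auto simp: under_def underS_def)
    ultimately show ?thesis using card_of_mono1 ordLeq_ordLess_trans by blast
  qed
  \<comment> \<open>The row \<open>h ({g} \<times> G)\<close> has the cardinality of \<open>G\<close>, so it is not contained in the
    finitely many initial segments below elements of \<open>S g\<close>; injectivity of \<open>j\<close> comes for
    free from that of \<open>h\<close>.\<close>
  have "\<exists>y\<in>G. \<forall>s\<in>S g. (s, h (g, y)) \<in> r" if "g \<in> G" for g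
  proof -
    let ?U = "\<lambda>T. \<Union>s\<in>T. under (card_of G) s"
    have "(card_of (?U T), card_of G) \<in> ordLess" if "finite T" "T \<subseteq> G" for T
      using that
    proof induction
      case empty
      show ?case using card_of_finite_ordLess_infinite[of "{}" G] inf by simp
    next
      case (insert x F)
      then show ?case using card_of_Un_ordLess_infinite[OF inf, of "under (card_of G) x" "?U F"] under by simp
    qed
    then have U: "(card_of (?U (S g)), card_of G) \<in> ordLess" using S that by blast
    have "inj_on (\<lambda>y. h (g, y)) G"
      using h(1) that by (auto simp: inj_on_def)
    then have "\<not> (\<lambda>y. h (g, y)) ` G \<subseteq> ?U (S g)"
      using U card_of_ordLess[of G "?U (S g)"] by blast
    then obtain y where y: "y \<in> G" "h (g, y) \<notin> ?U (S g)" by blast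
    have hG: "h (g, y) \<in> G" using h(2) y(1) that assms(3) by auto
    have "(s, h (g, y)) \<in> r" if s: "s \<in> S g" for s
    proof -
      have "(h (g, y), s) \<notin> card_of G" using y(2) s by (auto simp: under_def)
      moreover have "s \<in> G" using S \<open>g \<in> G\<close> s by blast
      moreover have "refl_on G (card_of G)" "total_on G (card_of G)"
        using wo by (auto simp: order_on_defs)
      ultimately show ?thesis
        using hG unfolding r_def total_on_def by (cases "s = h (g, y)") (auto dest: refl_onD)
    qed
    then show ?thesis using y(1) by blast
  qed
  then obtain y where y: "\<And>g. g \<in> G \<Longrightarrow> y g \<in> G" "\<And>g s. g \<in> G \<Longrightarrow> s \<in> S g \<Longrightarrow> (s, h (g, y g)) \<in> r"
    by metis
  show ?thesis
  proof (rule that[of r "\<lambda>g. h (g, y g)"])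
    show "inj_on (\<lambda>g. h (g, y g)) G"
      by (rule inj_onI) (use h(1) y(1) in \<open>auto dest!: inj_onD\<close>)
    show "(\<lambda>g. h (g, y g)) ` G \<subseteq> X" using h(2) y(1) by auto
  qed (use wf y(2) in auto)
qed

section \<open>Laurent polynomials and a freeness criterion\<close>

context vector_space
begin

lemma vector_space_laurent: "vector_space (\<lambda>c (q :: int \<Rightarrow>\<^sub>0 'a). Poly_Mapping.single 0 c * q)"
  by unfold_locales
    (simp_all add: algebra_simps single_add mult_single flip: single_one mult.assoc)

text \<open>Coordinate functionals can thus be defined as linear maps over the field, with only
  compatibility with \<open>t\<close> left to check: negative powers follow because \<open>t\<close>
  is a unit.\<close>

lemma laurent_hom:
  assumes v: "v \<in> GL scale"
    and \<Phi>: "Vector_Spaces.linear scale (\<lambda>c q. Poly_Mapping.single 0 c * q) \<Phi>"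
    and \<Phi>v: "\<And>x. \<Phi> (v x) = Poly_Mapping.single (1::int) 1 * \<Phi> x"
  shows "\<Phi> (laurent_scale scale v q x) = q * \<Phi> x"
proof -
  interpret \<Phi>: Vector_Spaces.linear scale "\<lambda>c q. Poly_Mapping.single 0 c * q" \<Phi> by (rule \<Phi>)
  have bij: "bij v" using v by (simp add: GL_def)
  have pow: "\<Phi> (int_funpow v k x) = Poly_Mapping.single k 1 * \<Phi> x" for k
  proof (induction k rule: int_induct[where k = 0])
    case base
    show ?case by (simp add: int_funpow_def)
  next
    case (step1 i)
    have "\<Phi> (int_funpow v (i + 1) x) = Poly_Mapping.single 1 1 * (Poly_Mapping.single i 1 * \<Phi> x)"
      using step1 by (simp only: int_funpow_succ[OF bij] \<Phi>v)
    then show ?case by (simp add: mult_single add.commute flip: mult.assoc)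
  next
    case (step2 i)
    have "Poly_Mapping.single 1 1 * \<Phi> (int_funpow v (i - 1) x) = Poly_Mapping.single i 1 * \<Phi> x"
      using step2 int_funpow_succ[OF bij, of "i - 1" x] \<Phi>v[of "int_funpow v (i - 1) x"] by simp
    then have "Poly_Mapping.single (-1) 1 * (Poly_Mapping.single 1 1 * \<Phi> (int_funpow v (i - 1) x))
        = Poly_Mapping.single (-1) 1 * (Poly_Mapping.single i 1 * \<Phi> x)" by simp
    then show ?case by (simp add: mult_single flip: mult.assoc)
  qed
  show ?thesis
  proof (induction q rule: laurent_induct)
    case (3 k c)
    show ?case by (simp add: laurent_scale_single \<Phi>.scale pow mult_single flip: mult.assoc)
  qed (simp_all add: laurent_scale_0 laurent_scale_add_left \<Phi>.zero \<Phi>.add distrib_right)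
qed

text \<open>The maps \<open>\<Phi>\<close> are coordinate functionals dual to \<open>F\<close>:
  applied to a linear relation, each isolates one coefficient. The condition \<open>spans\<close> is
  applied to the Laurent span of \<open>F\<close>, which is stable under \<open>v\<close> and its
  inverse.\<close>

lemma elementaryI:
  assumes v: "v \<in> GL scale"
    and spans: "\<And>M. subspace M \<Longrightarrow> F \<subseteq> M \<Longrightarrow> (\<And>x. v x \<in> M \<longleftrightarrow> x \<in> M) \<Longrightarrow> M = UNIV"
    and coords: "\<And>f. f \<in> F \<Longrightarrow> \<exists>\<Phi>. Vector_Spaces.linear scale (\<lambda>c q. Poly_Mapping.single 0 c * q) \<Phi>
      \<and> (\<forall>x. \<Phi> (v x) = Poly_Mapping.single (1::int) 1 * \<Phi> x)
      \<and> \<Phi> f = 1 \<and> (\<forall>g\<in>F - {f}. \<Phi> g = 0)"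
  shows "elementary scale v"
proof -
  interpret L: module "laurent_scale scale v" by (rule module_laurent_scale[OF v])
  have bij: "bij v" using v by (simp add: GL_def)
  have "\<not> L.dependent F"
  proof
    assume "L.dependent F"
    then obtain A c f where A: "finite A" "A \<subseteq> F" "(\<Sum>g\<in>A. laurent_scale scale v (c g) g) = 0"
      and f: "f \<in> A" "c f \<noteq> 0"
      unfolding L.dependent_explicit by blast
    from A f obtain \<Phi> where lin: "Vector_Spaces.linear scale (\<lambda>c q. Poly_Mapping.single 0 c * q) \<Phi>"
      and \<Phi>v: "\<And>x. \<Phi> (v x) = Poly_Mapping.single (1::int) 1 * \<Phi> x"
      and \<Phi>f: "\<Phi> f = 1" "\<And>g. g \<in> F \<Longrightarrow> g \<noteq> f \<Longrightarrow> \<Phi> g = 0"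
      using coords[of f] by blast
    interpret \<Phi>: Vector_Spaces.linear scale "\<lambda>c q. Poly_Mapping.single 0 c * q" \<Phi> by (rule lin)
    have "0 = \<Phi> (\<Sum>g\<in>A. laurent_scale scale v (c g) g)" using A(3) \<Phi>.zero by simp
    also have "\<dots> = (\<Sum>g\<in>A. c g * \<Phi> g)"
      by (simp add: \<Phi>.sum laurent_hom[OF v lin \<Phi>v])
    also have "\<dots> = (\<Sum>g\<in>A. if g = f then c f else 0)"
      by (rule sum.cong) (use A(2) \<Phi>f in auto)
    also have "\<dots> = c f" using A(1) f(1) by simp
    finally show False using f(2) by simp
  qed
  moreover have "L.span F = UNIV"
  proof (rule spans)
    have scale: "scale c x = laurent_scale scale v (Poly_Mapping.single 0 c) x" for c x
      by (simp add: laurent_scale_single int_funpow_def)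
    show "subspace (L.span F)"
      by (rule subspaceI)
        (auto simp only: scale intro: L.span_zero L.span_add L.span_scale)
    show "F \<subseteq> L.span F" by (rule L.span_superset)
    fix x
    have "v x \<in> L.span F" if "x \<in> L.span F"
      using L.span_scale[OF that, of "Poly_Mapping.single 1 1"] by (simp add: laurent_scale_indeterminate)
    moreover have "x \<in> L.span F" if "v x \<in> L.span F"
    proof -
      have "laurent_scale scale v (Poly_Mapping.single (-1) 1) (v x) = x"
        using int_funpow_neg[OF bij, of 1] bij by (simp add: laurent_scale_single bij_is_inj)
      then show ?thesis using L.span_scale[OF that, of "Poly_Mapping.single (-1) 1"] by simp
    qed
    ultimately show "v x \<in> L.span F \<longleftrightarrow> x \<in> L.span F" by blast
  qed
  ultimately show ?thesis
    unfolding elementary_def is_free_module_def using v L.module_axioms by blast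
qed

section \<open>Independent pairs from the absence of dominant eigenvalues\<close>

lemma cdim_le_card_of:
  assumes "independent S" "T \<subseteq> span S"
  shows "(cdim scale T, card_of S) \<in> ordLeq"
proof -
  obtain B where B: "B \<subseteq> T" "independent B" "T \<subseteq> span B"
    using maximal_independent_subset by blast
  have "span B = span T"
    using B span_mono span_minimal subspace_span by (metis subset_antisym)
  then have cdim: "(cdim scale T, card_of B) \<in> ordIso" using B(2) by (rule cdim_eqI[rotated])
  \<comment> \<open>Extending \<open>B\<close> to a basis of \<open>span S\<close> bounds it by
    \<open>S\<close>, since all bases of one space are equipotent.\<close>
  have "B \<subseteq> span S" using B(1) assms(2) by blast
  then obtain B' where B': "B \<subseteq> B'" "B' \<subseteq> span S" "independent B'" "span S \<subseteq> span B'"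
    using maximal_independent_subset_extend[OF _ B(2)] by blast
  then have "span B' = span S" by (metis span_minimal subset_antisym subspace_span)
  then have "(card_of B', card_of S) \<in> ordIso"
    using bij_if_span_eq_span_bases[OF B'(3) assms(1)] card_of_ordIso by blast
  then have "(card_of B, card_of S) \<in> ordLeq"
    using card_of_mono1[OF B'(1)] ordLeq_ordIso_trans by blast
  then show ?thesis using cdim ordIso_ordLeq_trans by blast
qed

text \<open>A version modulo \<open>span S\<close> of the fact that a linear map with only
  eigenvectors is a scalar; \<open>f\<close> is not assumed to preserve \<open>span S\<close>.
  Comparing \<open>y\<close>, \<open>x0\<close> and \<open>y + x0\<close> shows that vectors
  independent of \<open>x0\<close> modulo \<open>span S\<close> share its eigenvalue. Any other
  vector becomes independent of \<open>x0\<close> on adding \<open>y0\<close>.\<close>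

lemma scalar_mod_subspace:
  assumes f: "Vector_Spaces.linear scale scale f"
    and x0: "x0 \<notin> span S" and y0: "y0 \<notin> span (insert x0 S)"
    and ev: "\<And>x. x \<notin> span S \<Longrightarrow> \<exists>l. f x - scale l x \<in> span S"
  shows "\<exists>l. \<forall>x. f x - scale l x \<in> span S"
proof -
  interpret f: Vector_Spaces.linear scale scale f by (rule f)
  obtain l where l: "f x0 - scale l x0 \<in> span S" using ev[OF x0] by blast
  have key: "f y - scale l y \<in> span S" if y: "y \<notin> span (insert x0 S)" for y
  proof -
    have nspan: "y + scale k x0 \<notin> span S" for k
      using y span_breakdown_eq[of y x0 S] by (metis diff_minus_eq_add scale_minus_left)
    obtain m where m: "f y - scale m y \<in> span S" using ev[of y] nspan[of 0] by auto
    obtain n where n: "f (y + x0) - scale n (y + x0) \<in> span S"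
      using ev[of "y + x0"] nspan[of 1] by auto
    have "(f x0 - scale l x0) + (f y - scale m y) - (f (y + x0) - scale n (y + x0)) \<in> span S"
      by (intro span_diff span_add l m n)
    then have d: "scale (n - m) y + scale (n - l) x0 \<in> span S"
      by (simp add: f.add algebra_simps)
    have "n = m"
    proof (rule ccontr)
      assume "n \<noteq> m"
      then have "y + scale ((n - l) / (n - m)) x0 \<in> span S"
        using span_scale[OF d, of "1 / (n - m)"] by (simp add: scale_right_distrib)
      then show False using nspan by blast
    qed
    moreover have "n = l"
    proof (rule ccontr)
      assume "n \<noteq> l"
      then have "x0 \<in> span S"
        using span_scale[OF d, of "1 / (n - l)"] \<open>n = m\<close> by simp
      then show False using x0 by blast
    qed
    ultimately show ?thesis using m by simp
  qed
  have "f y - scale l y \<in> span S" for y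
  proof (cases "y \<in> span (insert x0 S)")
    case True
    then have "y + y0 \<notin> span (insert x0 S)"
      using y0 span_add_eq by blast
    then have "(f (y + y0) - scale l (y + y0)) - (f y0 - scale l y0) \<in> span S"
      by (intro span_diff key y0)
    then show ?thesis by (simp add: f.add algebra_simps)
  qed (rule key)
  then show ?thesis by blast
qed

text \<open>Take \<open>X\<close> maximal by Zorn and let \<open>S\<close> be the union of
  \<open>X\<close> and its image. If \<open>X\<close> were smaller than a basis, so would be
  \<open>S\<close>; by maximality \<open>u\<close> would be a scalar \<open>l\<close> modulo
  \<open>span S\<close>, hence \<open>u - l\<close> would have rank at most that of
  \<open>S\<close>, making \<open>l\<close> dominant.\<close>

lemma exists_independent_pairs:
  assumes inf: "\<not> (\<exists>B. finite B \<and> span B = UNIV)"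
    and u: "u \<in> GL scale" and nd: "\<not> (\<exists>l. dominant_eigenvalue scale u l)"
  obtains X where "X \<inter> u ` X = {}" "independent (X \<union> u ` X)"
    "\<And>B. independent B \<Longrightarrow> span B = UNIV \<Longrightarrow> (card_of B, card_of X) \<in> ordLeq"
proof -
  have lin: "Vector_Spaces.linear scale scale u" and inj: "inj u"
    using u by (auto simp: GL_def bij_is_inj)
  define \<A> where "\<A> = {X. X \<inter> u ` X = {} \<and> independent (X \<union> u ` X)}"
  have "\<exists>X\<in>\<A>. \<forall>Y\<in>\<A>. X \<subseteq> Y \<longrightarrow> Y = X"
  proof (rule subset_Zorn')
    fix C assume "subset.chain \<A> C"
    then have C: "\<And>X. X \<in> C \<Longrightarrow> X \<in> \<A>" "\<And>X Y. X \<in> C \<Longrightarrow> Y \<in> C \<Longrightarrow> X \<subseteq> Y \<or> Y \<subseteq> X"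
      by (auto simp: subset_chain_def)
    have "independent (\<Union>X\<in>C. X \<union> u ` X)"
    proof (rule independent_Union_directed)
      fix c d assume "c \<in> (\<lambda>X. X \<union> u ` X) ` C" "d \<in> (\<lambda>X. X \<union> u ` X) ` C"
      then obtain X Y where "X \<in> C" "Y \<in> C" "c = X \<union> u ` X" "d = Y \<union> u ` Y" by blast
      then show "c \<subseteq> d \<or> d \<subseteq> c" using C(2)[of X Y] by blast
    next
      fix c assume "c \<in> (\<lambda>X. X \<union> u ` X) ` C"
      then show "independent c" using C(1) by (auto simp: \<A>_def)
    qed
    moreover have "(\<Union>X\<in>C. X \<union> u ` X) = \<Union>C \<union> u ` \<Union>C" by blast
    moreover have "\<Union>C \<inter> u ` \<Union>C = {}"
    proof (rule ccontr)
      assume "\<Union>C \<inter> u ` \<Union>C \<noteq> {}"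
      then obtain X Y y where XY: "X \<in> C" "Y \<in> C" "y \<in> Y" "u y \<in> X" by blast
      then obtain Z where "Z \<in> C" "y \<in> Z" "u y \<in> Z" using C(2)[of X Y] by blast
      then show False using C(1)[of Z] by (auto simp: \<A>_def)
    qed
    ultimately show "\<Union>C \<in> \<A>" by (simp add: \<A>_def)
  qed
  then obtain X where X: "X \<inter> u ` X = {}" "independent (X \<union> u ` X)"
    and max: "\<And>Y. Y \<in> \<A> \<Longrightarrow> X \<subseteq> Y \<Longrightarrow> Y = X"
    by (auto simp: \<A>_def)
  define S where "S = X \<union> u ` X"
  \<comment> \<open>If \<open>x\<close> and \<open>u x\<close> were independent modulo
    \<open>span S\<close>, then \<open>x\<close> could be added to \<open>X\<close>.\<close>
  have ev: "\<exists>l. u x - scale l x \<in> span S" if x: "x \<notin> span S" for x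
  proof (rule ccontr)
    assume "\<nexists>l. u x - scale l x \<in> span S"
    then have ux: "u x \<notin> span (insert x S)" by (simp add: span_breakdown_eq)
    have "independent (insert (u x) (insert x S))"
      using ux x X(2) by (simp add: independent_insertI S_def)
    moreover have "insert (u x) (insert x S) = insert x X \<union> u ` insert x X" by (auto simp: S_def)
    moreover have "x \<notin> S" "u x \<notin> insert x S" using x ux span_base by blast+
    then have "insert x X \<inter> u ` insert x X = {}" using X(1) by (auto simp: S_def)
    ultimately have "insert x X \<in> \<A>" by (simp add: \<A>_def)
    then have "x \<in> X" using max by blast
    then show False using \<open>x \<notin> S\<close> by (simp add: S_def)
  qed
  have "(card_of B, card_of X) \<in> ordLeq" if B: "independent B" "span B = UNIV" for B
  proof (rule ccontr)
    assume "(card_of B, card_of X) \<notin> ordLeq"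
    then have X_less: "(card_of X, card_of B) \<in> ordLess"
      using not_ordLeq_iff_ordLess card_of_Well_order by blast
    have infB: "infinite B" using inf B(2) by blast
    have "(card_of (u ` X), card_of B) \<in> ordLess"
      using card_of_image X_less ordLeq_ordLess_trans by blast
    then have S_less: "(card_of S, card_of B) \<in> ordLess"
      unfolding S_def using X_less card_of_Un_ordLess_infinite[OF infB] by blast
    have nonspanning: "\<exists>x. x \<notin> span T"
      if "independent T" "(card_of T, card_of B) \<in> ordLess" for T
    proof (rule ccontr)
      assume "\<nexists>x. x \<notin> span T"
      then have "span T = span B" using B(2) by auto
      then have "(card_of T, card_of B) \<in> ordIso"
        using bij_if_span_eq_span_bases[OF that(1) B(1)] card_of_ordIso by blast
      then show False using that(2) not_ordLess_ordIso by blast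
    qed
    have indS: "independent S" using X(2) by (simp add: S_def)
    obtain x0 where x0: "x0 \<notin> span S" using nonspanning[OF indS S_less] by blast
    have "(card_of {x0}, card_of B) \<in> ordLess"
      by (rule card_of_finite_ordLess_infinite) (use infB in auto)
    then have "(card_of (insert x0 S), card_of B) \<in> ordLess"
      using card_of_Un_ordLess_infinite[OF infB, of "{x0}" S] S_less by simp
    then obtain y0 where y0: "y0 \<notin> span (insert x0 S)"
      using nonspanning independent_insertI[OF x0 indS] by blast
    obtain l where l: "\<And>x. u x - scale l x \<in> span S"
      using scalar_mod_subspace[OF lin x0 y0 ev] by blast
    have "(rk scale (\<lambda>x. u x - scale l x), card_of S) \<in> ordLeq"
      unfolding rk_def by (rule cdim_le_card_of[OF indS]) (use l in auto)
    moreover have "(card_of B, cdim scale UNIV) \<in> ordIso"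
      using cdim_eqI[OF B(1), of UNIV] B(2) ordIso_symmetric by simp
    ultimately have "dominant_eigenvalue scale u l"
      unfolding dominant_eigenvalue_def
      using S_less ordLeq_ordLess_trans ordLess_ordIso_trans by blast
    then show False using nd by blast
  qed
  then show ?thesis using that X by blast
qed

section \<open>Construction of the elementary multiple\<close>

lemma bij_of_quadratic:
  assumes a: "Vector_Spaces.linear scale scale a" and "d \<noteq> 0"
    and quad: "\<And>x. a (a x) - scale c (a x) + scale d x = 0"
  shows "bij a"
proof -
  interpret a: Vector_Spaces.linear scale scale a by (rule a)
  \<comment> \<open>The relation reads \<open>a (c - a) = d\<close>, which exhibits the inverse of
    \<open>a\<close>.\<close>
  let ?b = "\<lambda>x. scale (1 / d) (scale c x - a x)"
  have eq: "scale d x = scale c (a x) - a (a x)" for x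
    using quad[of x] by (simp add: algebra_simps add_eq_0_iff)
  have "?b (a x) = x" for x
    by (simp add: \<open>d \<noteq> 0\<close> flip: eq)
  moreover have "a (?b x) = x" for x
    by (simp add: a.scale a.diff \<open>d \<noteq> 0\<close> flip: eq)
  ultimately show ?thesis by (intro o_bij[of ?b a]) auto
qed

text \<open>The last condition is \<open>(a - al) (a - be) = 0\<close> expanded; \<open>al\<close>
  and \<open>be\<close> may coincide.\<close>

lemma exists_elementary_multiple:
  assumes inf: "\<not> (\<exists>B. finite B \<and> span B = UNIV)"
    and u: "u \<in> GL scale" and nd: "\<not> (\<exists>l. dominant_eigenvalue scale u l)"
    and nz: "al \<noteq> 0" "be \<noteq> 0"
  obtains a where "a \<in> GL scale" "elementary scale (a \<circ> u)"
    "\<And>x. a (a x) - scale (al + be) (a x) + scale (al * be) x = 0"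
proof -
  have lin_u: "Vector_Spaces.linear scale scale u" and bij_u: "bij u" and inj_u: "inj u"
    using u by (auto simp: GL_def bij_is_inj)
  interpret u: Vector_Spaces.linear scale scale u by (rule lin_u)
  interpret VV: vector_space_pair scale scale ..
  let ?T = "\<lambda>c (q :: int \<Rightarrow>\<^sub>0 'a). Poly_Mapping.single 0 c * q"
  interpret L: vector_space ?T by (rule vector_space_laurent)
  interpret VL: vector_space_pair scale ?T ..
  obtain X where X: "X \<inter> u ` X = {}" "independent (X \<union> u ` X)"
    and card_X: "\<And>B. independent B \<Longrightarrow> span B = UNIV \<Longrightarrow> (card_of B, card_of X) \<in> ordLeq"
    using exists_independent_pairs[OF inf u nd] by blast
  obtain B where B: "X \<union> u ` X \<subseteq> B" "independent B" and "UNIV \<subseteq> span B"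
    using maximal_independent_subset_extend[OF subset_UNIV X(2)] by metis
  then have span_B: "span B = UNIV" by auto
  \<comment> \<open>\<open>b\<close> is a bijection of \<open>G\<close> onto \<open>B - X\<close>; \<open>P\<close> is the projection onto
    the span of \<open>G\<close> along \<open>W\<close>.\<close>
  define G where "G = B - u ` X"
  define W where "W = span (u ` X)"
  define b where "b = (\<lambda>g. if g \<in> X then u g else g)"
  define supp where "supp = (\<lambda>y. {s \<in> G. representation B y s \<noteq> 0})"
  define P where "P = (\<lambda>y. \<Sum>s\<in>supp y. scale (representation B y s) s)"
  have XG: "X \<subseteq> G" using X(1) B(1) by (auto simp: G_def)
  have inj_b: "inj_on b G"
    by (rule inj_onI) (use inj_u in \<open>auto simp: b_def G_def dest: injD split: if_splits\<close>)
  have B_cases: "c \<in> X \<or> (\<exists>g\<in>G. c = b g)" if "c \<in> B" for c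
  proof (cases "c \<in> u ` X")
    case True
    then show ?thesis using XG by (auto simp: b_def)
  next
    case False
    then have "c \<in> G" using that by (simp add: G_def)
    then show ?thesis by (cases "c \<in> X") (auto simp: b_def)
  qed
  have b_notin_X: "b g \<notin> X" if "g \<in> G" for g
    using X(1) that by (auto simp: b_def G_def)
  have finite_supp: "finite (supp y)" for y
    by (rule finite_subset[OF _ finite_representation[of B y]]) (auto simp: supp_def)
  have diff_P: "y - P y \<in> W" for y
  proof -
    let ?A = "{s. representation B y s \<noteq> 0}"
    have "y = (\<Sum>s\<in>?A. scale (representation B y s) s)"
      using sum_nonzero_representation_eq[OF B(2), of y] span_B by simp
    also have "\<dots> = P y + (\<Sum>s\<in>?A - supp y. scale (representation B y s) s)"
      unfolding P_def
      by (subst sum.subset_diff[of "supp y"]) (auto simp: finite_representation supp_def add.commute)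
    finally have "y - P y = (\<Sum>s\<in>?A - supp y. scale (representation B y s) s)" by (simp add: algebra_simps)
    moreover have "s \<in> u ` X" if "s \<in> ?A - supp y" for s
      using that representation_ne_zero[of B y s] by (auto simp: supp_def G_def)
    ultimately show ?thesis by (auto simp: W_def intro!: span_sum span_scale intro: span_base)
  qed

  have "infinite B" using inf span_B by blast
  then have "infinite X" using card_of_ordLeq_finite card_X[OF B(2) span_B] by blast
  then have "infinite G" using XG infinite_super by blast
  moreover have "(card_of G, card_of X) \<in> ordLeq"
    using card_X[OF B(2) span_B] card_of_mono1[of G B] ordLeq_transitive by (auto simp: G_def)
  \<comment> \<open>The relation of \<open>b g\<close> involves \<open>g\<close> itself, as
    \<open>b g\<close> is \<open>u g\<close> or \<open>g\<close>, and the generators occurring in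
    \<open>P (u (b g))\<close>. The element \<open>j g\<close> must exceed them all.\<close>
  ultimately obtain j r where wf: "wf r" and j: "inj_on j G" "j ` G \<subseteq> X"
    and r: "\<And>g s. g \<in> G \<Longrightarrow> s \<in> insert g (supp (u (b g))) \<Longrightarrow> (s, j g) \<in> r"
  proof (rule well_founded_injection[OF _ _ XG, where S = "\<lambda>g. insert g (supp (u (b g)))"])
    show "finite (insert g (supp (u (b g))))" if "g \<in> G" for g
      using finite_supp by simp
    show "insert g (supp (u (b g))) \<subseteq> G" if "g \<in> G" for g
      using that by (auto simp: supp_def)
  qed blast

  \<comment> \<open>For \<open>c = b g\<close> the term \<open>inv_into G b c\<close> is
    \<open>g\<close>. The summand \<open>scale al (u (j g))\<close> is \<open>v (j g)\<close>,
    because \<open>j g\<close> lies in \<open>X\<close>; it belongs to \<open>W\<close>, so it is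
    invisible modulo \<open>W\<close>.\<close>
  obtain v where lin_v: "Vector_Spaces.linear scale scale v"
    and "\<forall>c\<in>B. v c = (if c \<in> X then scale al (u c)
      else scale be (P (u c)) + scale al (u (j (inv_into G b c))))"
    using VV.linear_independent_extend[OF B(2), of "\<lambda>c. if c \<in> X then scale al (u c)
      else scale be (P (u c)) + scale al (u (j (inv_into G b c)))"] by blast
  then have vX: "v x = scale al (u x)" if "x \<in> X" for x using that B(1) by auto
  have b_B: "b g \<in> B" if "g \<in> G" for g
    using that B(1) by (auto simp: b_def G_def)
  have vb: "v (b g) = scale be (P (u (b g))) + scale al (u (j g))" if "g \<in> G" for g
    using \<open>\<forall>c\<in>B. v c = _ c\<close> b_B[OF that] b_notin_X[OF that] inj_b that by simp
  interpret v: Vector_Spaces.linear scale scale v by (rule lin_v)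

  \<comment> \<open>This makes \<open>a\<close> act as \<open>be\<close> modulo \<open>W\<close>; by
    linearity the basis \<open>B\<close> suffices.\<close>
  have v_mod_W: "v x - scale be (u x) \<in> W" for x
  proof -
    have "subspace {x. v x - scale be (u x) \<in> W}"
    proof (rule subspaceI)
      show "0 \<in> {x. v x - scale be (u x) \<in> W}" by (simp add: v.zero u.zero W_def span_zero)
    next
      fix x y assume "x \<in> {x. v x - scale be (u x) \<in> W}" "y \<in> {x. v x - scale be (u x) \<in> W}"
      then have "(v x - scale be (u x)) + (v y - scale be (u y)) \<in> W"
        by (simp add: W_def span_add)
      then show "x + y \<in> {x. v x - scale be (u x) \<in> W}" by (simp add: v.add u.add algebra_simps)
    next
      fix c x assume "x \<in> {x. v x - scale be (u x) \<in> W}"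
      then have "scale c (v x - scale be (u x)) \<in> W" by (simp add: W_def span_scale)
      then show "scale c x \<in> {x. v x - scale be (u x) \<in> W}"
        by (simp add: v.scale u.scale scale_right_diff_distrib mult.commute)
    qed
    moreover have "B \<subseteq> {x. v x - scale be (u x) \<in> W}"
    proof
      fix c assume "c \<in> B"
      then consider "c \<in> X" | g where "g \<in> G" "c = b g" using B_cases by blast
      then have "v c - scale be (u c) \<in> W"
      proof cases
        case 1
        then have "scale (al - be) (u c) \<in> W" by (simp add: W_def span_base span_scale)
        then show ?thesis using 1 by (simp add: vX scale_left_diff_distrib)
      next
        case 2
        have "u (j g) \<in> W" using j(2) 2(1) by (auto simp: W_def intro: span_base)
        then have "scale al (u (j g)) - scale be (u c - P (u c)) \<in> W"
          using diff_P[of "u c"] unfolding W_def by (rule span_diff[OF span_scale span_scale])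
        then show ?thesis using 2 by (simp add: vb algebra_simps)
      qed
      then show "c \<in> {x. v x - scale be (u x) \<in> W}" by simp
    qed
    ultimately show ?thesis using span_minimal[of B] span_B by blast
  qed

  define a where "a = v \<circ> inv u"
  have au: "a (u x) = v x" for x by (simp add: a_def inj_u)
  then have a_comp: "a \<circ> u = v" by auto
  have u_inv: "u (inv u y) = y" for y using bij_u by (simp add: bij_is_surj surj_f_inv_f)
  have a_mod_W: "a y - scale be y \<in> W" for y
    using v_mod_W[of "inv u y"] by (simp add: a_def u_inv)
  have a_W: "a w = scale al w" if "w \<in> W" for w
  proof -
    have "W = u ` span X" unfolding W_def by (rule u.span_image)
    then obtain x where x: "x \<in> span X" "w = u x" using \<open>w \<in> W\<close> by blast
    have "v x = scale al (u x)"
    proof (rule VV.linear_eq_on[OF lin_v _ x(1)])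
      show "Vector_Spaces.linear scale scale (\<lambda>x. scale al (u x))"
        using VV.linear_compose_scale_right[OF lin_u] .
    qed (rule vX)
    then show ?thesis by (simp add: x au)
  qed
  have lin_inv: "Vector_Spaces.linear scale scale (inv u)"
    using linear_int_funpow[OF u, of "-1"] by (simp add: int_funpow_def)
  have lin_a: "Vector_Spaces.linear scale scale a"
    unfolding a_def by (rule Vector_Spaces.linear_compose[OF lin_inv lin_v])
  interpret a: Vector_Spaces.linear scale scale a by (rule lin_a)
  \<comment> \<open>The vector \<open>a x - be x\<close> lies in \<open>W\<close>, where
    \<open>a\<close> is multiplication by \<open>al\<close>.\<close>
  have quad: "a (a x) - scale (al + be) (a x) + scale (al * be) x = 0" for x
    using a_W[OF a_mod_W[of x]] by (simp add: a.diff a.scale algebra_simps)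
  have a_GL: "a \<in> GL scale"
    using lin_a bij_of_quadratic[OF lin_a _ quad] nz by (simp add: GL_def)
  have v_GL: "v \<in> GL scale"
    using lin_v a_GL bij_u bij_comp[of u a] by (simp add: GL_def a_comp)

  have "elementary scale v"
  proof (rule elementaryI[OF v_GL, where F = "G - j ` G"])
    fix M assume M: "subspace M" "G - j ` G \<subseteq> M" and vM: "\<And>x. v x \<in> M \<longleftrightarrow> x \<in> M"
    have uM: "u x \<in> M \<longleftrightarrow> x \<in> M" if "x \<in> X" for x
    proof -
      have "u x = scale (1 / al) (v x)" using nz by (simp add: vX that)
      then have "u x \<in> M \<longleftrightarrow> v x \<in> M"
        using subspace_scale[OF M(1), of "v x" "1 / al"] subspace_scale[OF M(1), of "u x" al] vX[OF that] by auto
      then show ?thesis using vM by simp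
    qed
    \<comment> \<open>Well-founded induction: for \<open>g = j h\<close>, the relation gives
      \<open>v (j h) = v (b h) - be P (u (b h))\<close>, whose right side involves only generators
      below \<open>g\<close>; stability of \<open>M\<close> then passes from \<open>v (j h)\<close>
      to \<open>j h\<close>.\<close>
    have GM: "g \<in> M" if "g \<in> G" for g
      using wf that
    proof (induction g)
      case (less g)
      show ?case
      proof (cases "g \<in> j ` G")
        case True
        then obtain h where h: "h \<in> G" "g = j h" by blast
        have IH: "s \<in> M" if "s \<in> insert h (supp (u (b h)))" for s
          using less.IH[of s] r[OF h(1) that] h that by (auto simp: supp_def)
        have "b h \<in> M" using IH[of h] uM[of h] by (auto simp: b_def)
        then have "v (b h) \<in> M" using vM by blast
        moreover have "P (u (b h)) \<in> M"
          unfolding P_def using IH by (intro subspace_sum subspace_scale M(1)) auto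
        ultimately have "v (b h) - scale be (P (u (b h))) \<in> M"
          by (intro subspace_diff subspace_scale M(1))
        moreover have "j h \<in> X" using j(2) h(1) by blast
        ultimately show ?thesis using vM[of "j h"] by (simp add: vb h vX)
      qed (use less.prems M(2) in blast)
    qed
    have "b g \<in> M" if "g \<in> G" for g using GM[OF that] uM[of g] by (auto simp: b_def)
    then have "B \<subseteq> M" using B_cases GM XG by blast
    then show "M = UNIV" using span_minimal[OF _ M(1)] span_B by blast
  next
    \<comment> \<open>The functional dual to \<open>f\<close>: its values on the free generators are
      prescribed, and those on the generators \<open>j h\<close> are forced by the
      relations.\<close>
    fix f assume f: "f \<in> G - j ` G"
    let ?t = "Poly_Mapping.single (1::int) (1::'a)" and ?t' = "Poly_Mapping.single (-1::int) (1::'a)"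
    have tt': "?t * (?t' * q) = q" for q by (simp add: mult_single flip: mult.assoc)
    \<comment> \<open>The recursion solves \<open>\<Phi> (v (b h)) = t * \<Phi> (b h)\<close> for \<open>\<Phi> (j h)\<close>.\<close>
    define H where "H = (\<lambda>\<phi> g. if g \<in> j ` G then let h = inv_into G j g in
        (if h \<in> X then ?T (1 / al) (?t * \<phi> h) else \<phi> h)
        - ?T be (?t' * (\<Sum>s\<in>supp (u (b h)). ?T (representation B (u (b h)) s) (\<phi> s)))
      else if g = f then 1 else 0)"
    define \<phi> where "\<phi> = wfrec r H"
    have \<phi>: "\<phi> g = H (cut \<phi> r g) g" for g unfolding \<phi>_def by (rule wfrec[OF wf])
    have \<phi>F: "\<phi> g = (if g = f then 1 else 0)" if "g \<notin> j ` G" for g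
      using \<phi>[of g] that by (simp add: H_def)
    have \<phi>j: "\<phi> (j h) = (if h \<in> X then ?T (1 / al) (?t * \<phi> h) else \<phi> h)
        - ?T be (?t' * (\<Sum>s\<in>supp (u (b h)). ?T (representation B (u (b h)) s) (\<phi> s)))"
      if h: "h \<in> G" for h
    proof -
      have "cut \<phi> r (j h) s = \<phi> s" if "s \<in> insert h (supp (u (b h)))" for s
        by (rule cut_apply[OF r[OF h that]])
      then show ?thesis using \<phi>[of "j h"] h j(1) by (simp add: H_def Let_def)
    qed
    \<comment> \<open>Outside \<open>G\<close> the basis consists of the vectors \<open>u x\<close>
      with \<open>x\<close> in \<open>X\<close>, where \<open>u x = v x / al\<close> forces the
      value.\<close>
    obtain \<Phi> where lin_\<Phi>: "Vector_Spaces.linear scale ?T \<Phi>"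
      and \<Phi>: "\<forall>c\<in>B. \<Phi> c = (if c \<in> G then \<phi> c else ?T (1 / al) (?t * \<phi> (inv u c)))"
      using VL.linear_independent_extend[OF B(2),
        of "\<lambda>c. if c \<in> G then \<phi> c else ?T (1 / al) (?t * \<phi> (inv u c))"] by blast
    interpret \<Phi>: Vector_Spaces.linear scale ?T \<Phi> by (rule lin_\<Phi>)
    have \<Phi>G: "\<Phi> g = \<phi> g" if "g \<in> G" for g using \<Phi> that by (auto simp: G_def)
    have \<Phi>u: "\<Phi> (u x) = ?T (1 / al) (?t * \<phi> x)" if "x \<in> X" for x
      using \<Phi> that B(1) inj_u by (auto simp: G_def)
    have \<Phi>P: "\<Phi> (P y) = (\<Sum>s\<in>supp y. ?T (representation B y s) (\<phi> s))" for y
      unfolding P_def \<Phi>.sum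
      by (rule sum.cong) (use \<Phi>G in \<open>auto simp: \<Phi>.scale supp_def\<close>)
    have \<Phi>j: "\<phi> (j g) = \<Phi> (b g) - ?T be (?t' * \<Phi> (P (u (b g))))" if "g \<in> G" for g
      using \<phi>j[OF that] \<Phi>G[OF that] \<Phi>u[of g] by (simp add: \<Phi>P b_def)
    have T_inv: "?T al (?T (1 / al) q) = q" for q using nz by simp
    have "\<Phi> (v x) = ?t * \<Phi> x" for x
    proof -
      have "subspace {x. \<Phi> (v x) = ?t * \<Phi> x}"
        by (rule subspaceI)
          (simp_all add: v.zero \<Phi>.zero v.add \<Phi>.add v.scale \<Phi>.scale distrib_left mult.left_commute)
      moreover have "B \<subseteq> {x. \<Phi> (v x) = ?t * \<Phi> x}"
      proof
        fix c assume "c \<in> B"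
        then consider "c \<in> X" | g where "g \<in> G" "c = b g" using B_cases by blast
        then have "\<Phi> (v c) = ?t * \<Phi> c"
        proof cases
          case 1
          then show ?thesis using \<Phi>G[of c] XG T_inv by (auto simp: vX \<Phi>.scale \<Phi>u)
        next
          case 2
          have jX: "j g \<in> X" using j(2) 2 by blast
          have "\<Phi> (v c) = ?T be (\<Phi> (P (u c))) + ?t * \<phi> (j g)"
            using 2 T_inv by (simp only: vb \<Phi>.add \<Phi>.scale \<Phi>u[OF jX])
          also have "?t * \<phi> (j g) = ?t * \<Phi> c - ?T be (?t * (?t' * \<Phi> (P (u c))))"
            using 2 by (simp only: \<Phi>j right_diff_distrib mult.left_commute)
          finally show ?thesis by (simp only: tt' add_diff_eq add_diff_cancel_left')
        qed
        then show "c \<in> {x. \<Phi> (v x) = ?t * \<Phi> x}" by simp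
      qed
      ultimately show ?thesis using span_minimal[of B] span_B by blast
    qed
    then show "\<exists>\<Phi>. Vector_Spaces.linear scale ?T \<Phi> \<and> (\<forall>x. \<Phi> (v x) = ?t * \<Phi> x)
      \<and> \<Phi> f = 1 \<and> (\<forall>g\<in>G - j ` G - {f}. \<Phi> g = 0)"
      using lin_\<Phi> f \<Phi>G \<phi>F by (intro exI[of _ \<Phi>]) auto
  qed
  then show ?thesis using that[OF a_GL _ quad] a_comp by simp
qed

end

section \<open>Split quadratic polynomials and the conclusion\<close>

lemma split_poly_degree_2E:
  fixes p :: "'a::field poly"
  assumes "split_poly p" "degree p = 2"
  obtains c al be where "c \<noteq> 0" "p = [:c * (al * be), - c * (al + be), c:]"
proof -
  obtain c rs where p: "p = smult c (\<Prod>r\<leftarrow>rs. [:- r, 1:])"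
    using assms(1) by (auto simp: split_poly_def)
  have "(\<Prod>r\<leftarrow>rs. [:- r, 1:]) \<noteq> (0 :: 'a poly)" for rs :: "'a list"
    by (auto simp: prod_list_zero_iff)
  then have "degree (\<Prod>r\<leftarrow>rs. [:- r, 1:]) = length rs"
    by (induction rs) (simp_all add: degree_mult_eq del: mult_pCons_left)
  then have c: "c \<noteq> 0" and "length rs = 2" using assms(2) p by (auto split: if_splits)
  then obtain al be where "rs = [al, be]"
    by (auto simp: numeral_2_eq_2 length_Suc_conv)
  then show ?thesis using that[OF c, of al be] p by (simp add: algebra_simps)
qed

theorem theorem1p11:
  fixes scale :: "'a::field \<Rightarrow> 'b::ab_group_add \<Rightarrow> 'b"
    and u :: "'b \<Rightarrow> 'b"
  assumes "vector_space scale"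
    and "\<not> (\<exists>B. finite B \<and> module.span scale B = UNIV)"
    and "u \<in> GL scale"
    and "\<not> (\<exists>l. dominant_eigenvalue scale u l)"
  shows "\<forall>p :: 'a poly. split_poly p \<and> non_derogatory p \<and> degree p = 2 \<longrightarrow>
    (\<exists>v. elementary scale v \<and> p_adjacent scale p u v)"
proof (intro allI impI, elim conjE)
  fix p :: "'a poly" assume p: "split_poly p" "non_derogatory p" "degree p = 2"
  interpret vector_space scale by (rule assms)
  obtain c al be where c: "c \<noteq> 0" and p_eq: "p = [:c * (al * be), - c * (al + be), c:]"
    using split_poly_degree_2E[OF p(1,3)] by blast
  have "al \<noteq> 0" "be \<noteq> 0" using p(2) by (auto simp: p_eq non_derogatory_def)
  then obtain a where a: "a \<in> GL scale" "elementary scale (a \<circ> u)"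
    and quad: "\<And>x. a (a x) - scale (al + be) (a x) + scale (al * be) x = 0"
    using exists_elementary_multiple[OF assms(2-4)] by metis
  have "poly_endo scale p a x = 0" for x
  proof -
    have "poly_endo scale p a x = scale c (a (a x) - scale (al + be) (a x) + scale (al * be) x)"
      using c by (simp add: poly_endo_def p_eq numeral_2_eq_2 algebra_simps)
    then show ?thesis using quad by simp
  qed
  then have "p_adjacent scale p u (a \<circ> u)"
    using a(1) by (auto simp: p_adjacent_def)
  then show "\<exists>v. elementary scale v \<and> p_adjacent scale p u v" using a(2) by blast
qed

end
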